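(* The relation $\equiv_i$ (iterative equivalence) is an option-regular equivalence relation on the class $\mathbf{PG}$ of combinatorial games. Moreover, $\equiv_i$ respects both $+$ and the Conway product $\cdot$, that is, for all $G,H,K,J\in\mathbf{PG}$, if $G\equiv_i H$ and $K\equiv_i J$, then $G+K\equiv_i H+J$ and $GK\equiv_i HJ$. The quotient $\mathbf{PG}/{\equiv_i}$, with the operations induced by $+$ and $\cdot$, is a commutative Ring with unity.
   Context: Games: a combinatorial game $G$ is a (possibly infinite, possibly partizan) well-founded two-player game of perfect information under normal play, given by a set of Left options $G^L$ and a set of Right options $G^R$, which are themselves games; one writes $G=\{\,G^L\mid G^R\,\}$. $\mathbf{PG}$ is the (proper) class of all such games. Games are taken as forms, considered up to isomorphism $\cong$ (extensional equality): $G\cong H$ if, recursively, every Left option of $G$ is $\cong$ to some Left option of $H$ and conversely, and similarly for Right options. $0=\{\,\mid\,\}$, $1=\{\,0\mid\,\}$. Operations: $G+H$ has Left options $G^L+H$, $G+H^L$ and Right options $G^R+H$, $G+H^R$. $-G=\{\,-G^R\mid -G^L\,\}$, and $G-H=G+(-H)$. The Conway product $GH=G\cdot H$ has Left options $G^LH+GH^L-G^LH^L$ and $G^RH+GH^R-G^RH^R$, and Right options $G^LH+GH^R-G^LH^R$ and $G^RH+GH^L-G^RH^L$, for arbitrary options of $G$ and $H$. Iteratively zero: recursively, $G$ is iteratively zero if for every Left option $G^L$ of $G$ there is a Right option $G^{LR}$ of $G^L$ which is iteratively zero, and for every Right option $G^R$ of $G$ there is a Left option $G^{RL}$ of $G^R$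 which is iteratively zero. Define $G\equiv_i H$ if $G-H$ is iteratively zero. Option-regular: an equivalence relation $\equiv$ on $\mathbf{PG}$ is option-regular if $G\equiv H$ whenever every Left option of $G$ is $\equiv$ to some Left option of $H$, every Left option of $H$ is $\equiv$ to some Left option of $G$, every Right option of $G$ is $\equiv$ to some Right option of $H$, and every Right option of $H$ is $\equiv$ to some Right option of $G$. "Ring" (capitalized) means a ring whose underlying collection may be a proper class. *)

theory Defs
  imports "HOL-Library.Equipollence" "HOL-Library.Infinite_Typeclass" "HOL-Algebra.Ring"
begin

section \<open>Combinatorial games\<close>

text \<open>
  There is no type of all sets in HOL, hence no type of all games.  Instead we build, for every
  infinite type \<open>'a\<close>, the type \<open>'a game\<close> of all well-founded games in which every position has at
  most \<open>|'a|\<close> Left options and at most \<open>|'a|\<close> Right options.  The type \<open>'a\<close> only serves as a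
  cardinal bound, and \<open>'a game\<close> is closed under options, sums, negatives and products.  The
  polymorphic \<open>'a\<close> stands for an arbitrarily large bound.

  A form enumerates its Left and its Right options by two partial functions on \<open>'a\<close>; a game is a
  form up to the isomorphism that disregards the enumeration.  Hence equality of games is
  extensional, and a game is given by its two sets of options (\<open>game_eqI\<close>, \<open>make_game_opts\<close>).
\<close>

datatype 'a form = Form (left_enum: "'a \<Rightarrow> 'a form option") (right_enum: "'a \<Rightarrow> 'a form option")

inductive form_iso :: "'a form \<Rightarrow> 'a form \<Rightarrow> bool" where
  "\<lbrakk>\<forall>X\<in>ran (left_enum G). \<exists>Y\<in>ran (left_enum H). form_iso X Y;
    \<forall>Y\<in>ran (left_enum H). \<exists>X\<in>ran (left_enum G). form_iso X Y;
    \<forall>X\<in>ran (right_enum G). \<exists>Y\<in>ran (right_enum H). form_iso X Y;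
    \<forall>Y\<in>ran (right_enum H). \<exists>X\<in>ran (right_enum G). form_iso X Y\<rbrakk>
   \<Longrightarrow> form_iso G H"

lemma form_iso_refl: "form_iso G G"
proof (induction G)
  case (Form f g)
  have "form_iso X X" if "X \<in> ran f" for X
    using that Form(1)[OF rangeI] by (auto simp: ran_def)
  moreover have "form_iso X X" if "X \<in> ran g" for X
    using that Form(2)[OF rangeI] by (auto simp: ran_def)
  ultimately show ?case
    by (intro form_iso.intros) auto
qed

lemma form_iso_sym: "form_iso G H \<Longrightarrow> form_iso H G"
  by (induction rule: form_iso.induct) (rule form_iso.intros; blast)

lemma form_iso_trans: "form_iso G H \<Longrightarrow> form_iso H K \<Longrightarrow> form_iso G K"
proof (induction arbitrary: K rule: form_iso.induct)
  case (1 G H)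
  from \<open>form_iso H K\<close> show ?case
  proof cases
    case 1
    show ?thesis
      by (rule form_iso.intros) (use 1 "1.IH" in meson)+
  qed
qed

quotient_type 'a game = "'a form" / form_iso
  by (intro equivpI reflpI sympI transpI) (blast intro: form_iso_refl form_iso_sym form_iso_trans)+

definition left_opts :: "'a game \<Rightarrow> 'a game set" where
  "left_opts G = abs_game ` ran (left_enum (rep_game G))"

definition right_opts :: "'a game \<Rightarrow> 'a game set" where
  "right_opts G = abs_game ` ran (right_enum (rep_game G))"

definition opts_rel :: "('a game \<times> 'a game) set" where
  "opts_rel = {(X, G). X \<in> left_opts G \<union> right_opts G}"

definition make_game :: "'a game set \<Rightarrow> 'a game set \<Rightarrow> 'a game" where
  "make_game L R = (THE G. left_opts G = L \<and> right_opts G = R)"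

lemma form_iso_rep_abs: "form_iso (rep_game (abs_game X)) X"
  by (metis Quotient_game Quotient_rel_rep Quotient_rep_abs form_iso_refl)

lemma abs_game_eq_iff: "abs_game X = abs_game Y \<longleftrightarrow> form_iso X Y"
  by (rule game.abs_eq_iff)

lemma left_opts_abs: "left_opts (abs_game X) = abs_game ` ran (left_enum X)"
proof -
  show ?thesis
    using form_iso_rep_abs[of X] unfolding left_opts_def
    by cases (auto simp: image_iff abs_game_eq_iff, metis form_iso_sym)
qed

lemma right_opts_abs: "right_opts (abs_game X) = abs_game ` ran (right_enum X)"
proof -
  show ?thesis
    using form_iso_rep_abs[of X] unfolding right_opts_def
    by cases (auto simp: image_iff abs_game_eq_iff, metis form_iso_sym)
qed

lemma game_eqI:
  fixes G H :: "'a game"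
  assumes "left_opts G = left_opts H" "right_opts G = right_opts H"
  shows "G = H"
proof -
  obtain X Y where XY: "G = abs_game X" "H = abs_game Y"
    by (metis Quotient_game Quotient_abs_rep)
  have l: "abs_game ` ran (left_enum X) = abs_game ` ran (left_enum Y)"
    and r: "abs_game ` ran (right_enum X) = abs_game ` ran (right_enum Y)"
    using assms by (simp_all add: XY left_opts_abs right_opts_abs)
  have match: "\<exists>B\<in>T. form_iso A B"
    if "abs_game ` S = abs_game ` T" "A \<in> S" for S T :: "'a form set" and A
  proof -
    have "abs_game A \<in> abs_game ` T"
      using that by blast
    then show ?thesis
      by (auto simp: abs_game_eq_iff)
  qed
  have "form_iso X Y"
  proof (rule form_iso.intros)
    show "\<forall>A\<in>ran (left_enum X). \<exists>B\<in>ran (left_enum Y). form_iso A B"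
      using match[OF l] match[OF l[symmetric]] form_iso_sym by blast
    show "\<forall>B\<in>ran (left_enum Y). \<exists>A\<in>ran (left_enum X). form_iso A B"
      using match[OF l] match[OF l[symmetric]] form_iso_sym by blast
    show "\<forall>A\<in>ran (right_enum X). \<exists>B\<in>ran (right_enum Y). form_iso A B"
      using match[OF r] match[OF r[symmetric]] form_iso_sym by blast
    show "\<forall>B\<in>ran (right_enum Y). \<exists>A\<in>ran (right_enum X). form_iso A B"
      using match[OF r] match[OF r[symmetric]] form_iso_sym by blast
  qed
  then show ?thesis
    by (simp add: XY abs_game_eq_iff)
qed

lemma lepoll_UNIV_iff_ran: "A \<lesssim> (UNIV :: 'a set) \<longleftrightarrow> (\<exists>f :: 'a \<Rightarrow> 'b option. A = ran f)"
proof
  assume "A \<lesssim> (UNIV :: 'a set)"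
  then obtain h :: "'b \<Rightarrow> 'a" where h: "inj_on h A"
    by (auto simp: lepoll_def)
  define f where "f = (\<lambda>i. if i \<in> h ` A then Some (the_inv_into A h i) else None)"
  have "A = ran f"
  proof (intro equalityI subsetI)
    fix x assume "x \<in> A"
    then have "f (h x) = Some x"
      using h by (simp add: f_def the_inv_into_f_f)
    then show "x \<in> ran f" by (rule ranI)
  next
    fix x assume "x \<in> ran f"
    then obtain i where "f i = Some x" by (auto simp: ran_def)
    then show "x \<in> A"
      using h by (auto simp: f_def the_inv_into_f_f split: if_splits)
  qed
  then show "\<exists>f :: 'a \<Rightarrow> 'b option. A = ran f" by blast
next
  assume "\<exists>f :: 'a \<Rightarrow> 'b option. A = ran f"
  then obtain f :: "'a \<Rightarrow> 'b option" where "A = ran f" by blast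
  then have "A \<subseteq> (\<lambda>i. the (f i)) ` UNIV"
    by (auto simp: ran_def image_iff) (metis option.sel)
  then show "A \<lesssim> (UNIV :: 'a set)"
    by (rule subset_image_lepoll)
qed

lemma left_opts_lepoll: "left_opts (G :: 'a game) \<lesssim> (UNIV :: 'a set)"
  unfolding left_opts_def
  by (rule lepoll_trans[OF image_lepoll]) (auto simp: lepoll_UNIV_iff_ran)

lemma right_opts_lepoll: "right_opts (G :: 'a game) \<lesssim> (UNIV :: 'a set)"
  unfolding right_opts_def
  by (rule lepoll_trans[OF image_lepoll]) (auto simp: lepoll_UNIV_iff_ran)

lemma make_game_opts:
  fixes L R :: "'a game set"
  assumes "L \<lesssim> (UNIV :: 'a set)" "R \<lesssim> (UNIV :: 'a set)"
  shows "left_opts (make_game L R) = L" "right_opts (make_game L R) = R"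
proof -
  have ex: "\<exists>f :: 'a \<Rightarrow> 'a form option. A = abs_game ` ran f"
    if "A \<lesssim> (UNIV :: 'a set)" for A :: "'a game set"
  proof -
    have "rep_game ` A \<lesssim> (UNIV :: 'a set)"
      using image_lepoll that by (rule lepoll_trans)
    then obtain f :: "'a \<Rightarrow> 'a form option" where "rep_game ` A = ran f"
      by (auto simp: lepoll_UNIV_iff_ran)
    moreover have "abs_game ` rep_game ` A = A"
      by (simp add: image_image Quotient_abs_rep[OF Quotient_game])
    ultimately show ?thesis by metis
  qed
  obtain f g :: "'a \<Rightarrow> 'a form option" where "L = abs_game ` ran f" "R = abs_game ` ran g"
    using ex[OF assms(1)] ex[OF assms(2)] by blast
  then have fg: "left_opts (abs_game (Form f g)) = L \<and> right_opts (abs_game (Form f g)) = R"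
    by (simp add: left_opts_abs right_opts_abs)
  have "left_opts (make_game L R) = L \<and> right_opts (make_game L R) = R"
    unfolding make_game_def
    by (rule theI, rule fg) (use fg in \<open>auto intro: game_eqI\<close>)
  then show "left_opts (make_game L R) = L" "right_opts (make_game L R) = R"
    by auto
qed

lemma wf_opts_rel: "wf opts_rel"
proof (rule wfUNIVI)
  fix P :: "'a game \<Rightarrow> bool" and G
  assume step: "\<forall>G. (\<forall>X. (X, G) \<in> opts_rel \<longrightarrow> P X) \<longrightarrow> P G"
  have "P (abs_game X)" for X
  proof (induction X)
    case (Form f g)
    have "P (abs_game Y)" if "Y \<in> ran f \<union> ran g" for Y
      using that Form(1)[OF rangeI] Form(2)[OF rangeI] by (auto simp: ran_def)
    then have "P Z" if "(Z, abs_game (Form f g)) \<in> opts_rel" for Z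
      using that by (auto simp: opts_rel_def left_opts_abs right_opts_abs)
    then show ?case
      using step by blast
  qed
  then show "P G"
    by (metis Quotient_game Quotient_abs_rep)
qed

lemma opts_relI [intro]:
  "X \<in> left_opts G \<Longrightarrow> (X, G) \<in> opts_rel"
  "X \<in> right_opts G \<Longrightarrow> (X, G) \<in> opts_rel"
  by (auto simp: opts_rel_def)


section \<open>Operations\<close>

text \<open>
  The games built below are legitimate because \<open>'a\<close> is infinite: the sets of options passed to
  \<^const>\<open>make_game\<close> have cardinality at most \<open>|'a|\<close> again, see the lemmas about
  \<^const>\<open>left_opts\<close> and \<^const>\<open>right_opts\<close> at the end of this section.
\<close>

instantiation game :: (infinite) "{zero, one, plus, uminus, minus, times}"
begin

definition "0 = make_game {} {}"

definition "1 = make_game {0} {}"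

function plus_game :: "'a game \<Rightarrow> 'a game \<Rightarrow> 'a game" where
  "plus_game G H = make_game
     ((\<lambda>X. plus_game X H) ` left_opts G \<union> (\<lambda>Y. plus_game G Y) ` left_opts H)
     ((\<lambda>X. plus_game X H) ` right_opts G \<union> (\<lambda>Y. plus_game G Y) ` right_opts H)"
  by auto
termination
  by (relation "opts_rel <*lex*> opts_rel") (auto intro: wf_opts_rel)
declare plus_game.simps [simp del]

function uminus_game :: "'a game \<Rightarrow> 'a game" where
  "uminus_game G = make_game (uminus_game ` right_opts G) (uminus_game ` left_opts G)"
  by auto
termination
  by (relation opts_rel) (auto intro: wf_opts_rel)
declare uminus_game.simps [simp del]

definition "G - H = G + (- H)" for G H :: "'a game"

function times_game :: "'a game \<Rightarrow> 'a game \<Rightarrow> 'a game" where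
  "times_game G H = make_game
     ((\<lambda>(X, Y). times_game X H + times_game G Y - times_game X Y) ` (left_opts G \<times> left_opts H) \<union>
      (\<lambda>(X, Y). times_game X H + times_game G Y - times_game X Y) ` (right_opts G \<times> right_opts H))
     ((\<lambda>(X, Y). times_game X H + times_game G Y - times_game X Y) ` (left_opts G \<times> right_opts H) \<union>
      (\<lambda>(X, Y). times_game X H + times_game G Y - times_game X Y) ` (right_opts G \<times> left_opts H))"
  by auto
termination
  by (relation "opts_rel <*lex*> opts_rel") (auto intro: wf_opts_rel)
declare times_game.simps [simp del]

instance ..

end

lemma Un_lepoll_UNIV:
  assumes "A \<lesssim> (UNIV :: 'a::infinite set)" "B \<lesssim> (UNIV :: 'a set)"
  shows "A \<union> B \<lesssim> (UNIV :: 'a set)"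
proof -
  have "ordLeq3 (card_of (A \<union> B)) (card_of (UNIV :: 'a set))"
    using assms infinite_UNIV[where 'a='a]
    by (intro card_of_Un_ordLeq_infinite_Field)
       (auto simp: lepoll_def card_of_ordLeq[symmetric] Field_card_of card_of_card_order_on)
  then show ?thesis
    by (simp add: lepoll_def card_of_ordLeq[symmetric])
qed

lemma Times_lepoll_UNIV:
  assumes "A \<lesssim> (UNIV :: 'a::infinite set)" "B \<lesssim> (UNIV :: 'a set)"
  shows "A \<times> B \<lesssim> (UNIV :: 'a set)"
proof -
  have "A \<times> B \<lesssim> (UNIV :: 'a set) \<times> (UNIV :: 'a set)"
    using assms by (rule times_lepoll_mono)
  also have "(UNIV :: 'a set) \<times> (UNIV :: 'a set) \<approx> (UNIV :: 'a set)"
    using card_of_Times_same_infinite[OF infinite_UNIV[where 'a='a]]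
    by (simp add: eqpoll_iff_card_of_ordIso)
  finally show ?thesis .
qed

lemmas lepoll_UNIV_intros =
  Un_lepoll_UNIV Times_lepoll_UNIV lepoll_trans[OF image_lepoll]
  left_opts_lepoll right_opts_lepoll

lemma zero_game_opts [simp]:
  "left_opts (0 :: 'a::infinite game) = {}" "right_opts (0 :: 'a::infinite game) = {}"
  by (simp_all add: zero_game_def make_game_opts)

lemma one_game_opts [simp]:
  "left_opts (1 :: 'a::infinite game) = {0}" "right_opts (1 :: 'a::infinite game) = {}"
proof -
  have "{0 :: 'a game} \<lesssim> (UNIV :: 'a set)"
    by (simp add: lepoll_def)
  then show "left_opts (1 :: 'a game) = {0}" "right_opts (1 :: 'a game) = {}"
    by (simp_all add: one_game_def make_game_opts)
qed

lemma uminus_game_opts: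
  "left_opts (- G :: 'a::infinite game) = {- X | X. X \<in> right_opts G}"
  "right_opts (- G) = {- X | X. X \<in> left_opts G}"
  by (subst uminus_game.simps, subst make_game_opts; (intro lepoll_UNIV_intros)?; auto simp: image_iff)+

lemma plus_game_opts:
  "left_opts (G + H :: 'a::infinite game) =
     {X + H | X. X \<in> left_opts G} \<union> {G + Y | Y. Y \<in> left_opts H}"
  "right_opts (G + H) =
     {X + H | X. X \<in> right_opts G} \<union> {G + Y | Y. Y \<in> right_opts H}"
  by (subst plus_game.simps, subst make_game_opts; (intro lepoll_UNIV_intros)?; auto simp: image_iff)+

lemma times_game_opts:
  "left_opts (G * H :: 'a::infinite game) =
     {X * H + G * Y - X * Y | X Y. X \<in> left_opts G \<and> Y \<in> left_opts H} \<union>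
     {X * H + G * Y - X * Y | X Y. X \<in> right_opts G \<and> Y \<in> right_opts H}"
  "right_opts (G * H) =
     {X * H + G * Y - X * Y | X Y. X \<in> left_opts G \<and> Y \<in> right_opts H} \<union>
     {X * H + G * Y - X * Y | X Y. X \<in> right_opts G \<and> Y \<in> left_opts H}"
  by (subst times_game.simps, subst make_game_opts; (intro lepoll_UNIV_intros)?; auto simp: image_iff)+


section \<open>Iterative equivalence\<close>

text \<open>As games are well-founded, the inductive predicate is the one defined by recursion.\<close>

inductive iteratively_zero :: "'a game \<Rightarrow> bool" where
  "\<lbrakk>\<forall>X\<in>left_opts G. \<exists>Y\<in>right_opts X. iteratively_zero Y;
    \<forall>X\<in>right_opts G. \<exists>Y\<in>left_opts X. iteratively_zero Y\<rbrakk>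
   \<Longrightarrow> iteratively_zero G"

definition iter_equiv :: "'a::infinite game \<Rightarrow> 'a game \<Rightarrow> bool"  (infix \<open>\<equiv>\<^sub>i\<close> 50) where
  "G \<equiv>\<^sub>i H \<longleftrightarrow> iteratively_zero (G - H)"

definition option_regular :: "('a game \<Rightarrow> 'a game \<Rightarrow> bool) \<Rightarrow> bool" where
  "option_regular E \<longleftrightarrow>
     (\<forall>G H. (\<forall>X\<in>left_opts G. \<exists>Y\<in>left_opts H. E X Y) \<and>
            (\<forall>Y\<in>left_opts H. \<exists>X\<in>left_opts G. E Y X) \<and>
            (\<forall>X\<in>right_opts G. \<exists>Y\<in>right_opts H. E X Y) \<and>
            (\<forall>Y\<in>right_opts H. \<exists>X\<in>right_opts G. E Y X)
        \<longrightarrow> E G H)"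

definition iter_rel :: "('a::infinite game \<times> 'a game) set" where
  "iter_rel = {(G, H). G \<equiv>\<^sub>i H}"

text \<open>
  The class \<open>X + Y\<close> is the union of the classes of \<open>G + H\<close> for \<open>G \<in> X\<close>, \<open>H \<in> Y\<close>; it is
  a single class once the relation is known to respect \<open>+\<close>.  Likewise for the product.
\<close>

definition iter_quotient :: "'a::infinite game set ring" where
  "iter_quotient =
     \<lparr>carrier = UNIV // iter_rel,
      monoid.mult = (\<lambda>X Y. \<Union>G\<in>X. \<Union>H\<in>Y. iter_rel `` {G * H}),
      one = iter_rel `` {1},
      zero = iter_rel `` {0},
      add = (\<lambda>X Y. \<Union>G\<in>X. \<Union>H\<in>Y. iter_rel `` {G + H})\<rparr>"

end

theory Submission
  imports Defs
begin

text \<open>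
  The games that are iteratively zero are closed under sums and can be cancelled from sums, so
  \<open>\<equiv>\<^sub>i\<close> is a congruence for \<open>+\<close> whose quotient is an abelian group. Moreover \<open>\<equiv>\<^sub>i\<close> is
  option-regular: a move in \<open>G - H\<close> is answered by the matching option of the other summand.
  Conway's inductive proofs of the ring laws compare the options of both sides modulo the laws
  for smaller games and the laws of abelian groups, and therefore hold modulo \<open>\<equiv>\<^sub>i\<close>. Finally, if
  \<open>Z\<close> is iteratively zero, then so is \<open>Z * K\<close>: the move to \<open>X * K + Z * Y - X * Y\<close> is
  answered by \<open>X' * K + X * Y - X' * Y\<close> in the first summand, where \<open>X'\<close> is the answer to
  the move \<open>X\<close> in \<open>Z\<close>; the result is \<open>X' * K - X' * Y + Z * Y\<close> up to \<open>\<equiv>\<^sub>i\<close>.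
  Together with distributivity this shows that \<open>\<equiv>\<^sub>i\<close> respects products.
\<close>

section \<open>Options of either player\<close>

text \<open>
  Left is \<^const>\<open>True\<close>. With this encoding, options \<open>X\<close> of \<open>G\<close> and \<open>Y\<close> of \<open>H\<close> for the players
  \<open>p\<close> and \<open>q\<close> yield an option of \<open>G * H\<close> for the player \<open>p = q\<close>.
\<close>

definition opts :: "bool \<Rightarrow> 'a game \<Rightarrow> 'a game set" where
  "opts s G = (if s then left_opts G else right_opts G)"

lemma game_induct [case_names opts]:
  assumes "\<And>G. (\<And>s X. X \<in> opts s G \<Longrightarrow> P X) \<Longrightarrow> P G"
  shows "P G"
proof (induction G rule: wf_induct_rule[OF wf_opts_rel])
  case (1 G)
  then show ?case
    by (rule assms) (auto simp: opts_def opts_rel_def split: if_splits)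
qed

lemma game_opts_eqI:
  assumes "\<And>s. opts s G = opts s H"
  shows "G = H"
  using assms[of True] assms[of False] by (simp add: opts_def game_eqI)

lemma opts_zero [simp]: "opts s (0 :: 'a::infinite game) = {}"
  by (simp add: opts_def)

lemma opts_one: "opts s (1 :: 'a::infinite game) = (if s then {0} else {})"
  by (simp add: opts_def)

lemma opts_uminus: "opts s (- G :: 'a::infinite game) = uminus ` opts (\<not> s) G"
  by (auto simp: opts_def uminus_game_opts)

lemma opts_plus:
  "opts s (G + H :: 'a::infinite game) = (\<lambda>X. X + H) ` opts s G \<union> (\<lambda>Y. G + Y) ` opts s H"
  by (auto simp: opts_def plus_game_opts)

lemma opts_times:
  "opts s (G * H :: 'a::infinite game) =
     {X * H + G * Y - X * Y | p q X Y. X \<in> opts p G \<and> Y \<in> opts q H \<and> s = (p = q)}"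
  by (rule Set.set_eqI, cases s) (simp_all add: opts_def times_game_opts ex_bool_eq)

lemma opts_timesI:
  fixes G H :: "'a::infinite game"
  assumes "X \<in> opts p G" "Y \<in> opts q H"
  shows "X * H + G * Y - X * Y \<in> opts (p = q) (G * H)"
  using assms unfolding opts_times by blast

lemma opts_timesE:
  fixes G H :: "'a::infinite game"
  assumes "W \<in> opts s (G * H)"
  obtains p q X Y where "X \<in> opts p G" "Y \<in> opts q H" "s = (p = q)"
    "W = X * H + G * Y - X * Y"
  using assms unfolding opts_times by blast


section \<open>Laws that hold for forms\<close>

text \<open>The laws of sums hold as equalities of games, because the induction hypotheses make the
  option sets of both sides literally equal. The outer hypothesis is kept for every
  \<open>H\<close>, since the inner induction varies it.\<close>

lemma plus_game_commute: "G + H = H + (G :: 'a::infinite game)"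
proof (induction G arbitrary: H rule: game_induct)
  case (opts G)
  note G = this
  show ?case
  proof (induction H rule: game_induct)
    case (opts H)
    show ?case
      by (rule game_opts_eqI) (simp add: opts_plus G[of _ _ H] opts Un_commute cong: image_cong)
  qed
qed

lemma plus_game_assoc: "(G + H) + K = G + (H + K :: 'a::infinite game)"
proof (induction G arbitrary: H K rule: game_induct)
  case (opts G)
  note G = this
  show ?case
  proof (induction H arbitrary: K rule: game_induct)
    case (opts H)
    note H = this
    show ?case
    proof (induction K rule: game_induct)
      case (opts K)
      show ?case
        by (rule game_opts_eqI)
           (simp add: opts_plus image_Un image_image G H opts Un_assoc cong: image_cong)
    qed
  qed
qed

lemma plus_game_zero: "0 + G = (G :: 'a::infinite game)"
proof (induction G rule: game_induct)
  case (opts G)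
  then show ?case
    by (intro game_opts_eqI) (simp add: opts_plus cong: image_cong)
qed

instance game :: (infinite) comm_monoid_add
  by standard (fact plus_game_assoc plus_game_commute plus_game_zero)+

lemma minus_minus_game: "- (- G) = (G :: 'a::infinite game)"
proof (induction G rule: game_induct)
  case (opts G)
  then show ?case
    by (intro game_opts_eqI) (simp add: opts_uminus image_image cong: image_cong)
qed

lemma minus_zero_game: "- 0 = (0 :: 'a::infinite game)"
  by (rule game_opts_eqI) (simp add: opts_uminus)

lemma minus_plus_game: "- (G + H) = - G + - (H :: 'a::infinite game)"
proof (induction G arbitrary: H rule: game_induct)
  case (opts G)
  note G = this
  show ?case
  proof (induction H rule: game_induct)
    case (opts H)
    show ?case
      by (rule game_opts_eqI)
         (simp add: opts_uminus opts_plus image_Un image_image G opts cong: image_cong)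
  qed
qed

lemma minus_diff_game: "- (G - H) = H - (G :: 'a::infinite game)"
  by (simp add: minus_game_def minus_plus_game minus_minus_game add.commute)

lemma times_game_commute: "G * H = H * (G :: 'a::infinite game)"
proof (induction G arbitrary: H rule: game_induct)
  case (opts G)
  note G = this
  show ?case
  proof (induction H rule: game_induct)
    case (opts H)
    have swap: "X * H + G * Y - X * Y = Y * G + H * X - Y * X"
      if "X \<in> opts p G" "Y \<in> opts q H" for X Y p q
      using G[OF that(1), of H] G[OF that(1), of Y] opts[OF that(2)] by (simp add: add.commute)
    show ?case
    proof (intro game_opts_eqI equalityI subsetI)
      fix s W
      assume "W \<in> opts s (G * H)"
      then obtain p q X Y where XY: "X \<in> opts p G" "Y \<in> opts q H" "s = (p = q)"
        and W: "W = X * H + G * Y - X * Y"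
        by (rule opts_timesE)
      have "(q = p) = s"
        using XY(3) by blast
      then show "W \<in> opts s (H * G)"
        using opts_timesI[OF XY(2,1)] swap[OF XY(1,2)] W by simp
    next
      fix s W
      assume "W \<in> opts s (H * G)"
      then obtain q p Y X where XY: "Y \<in> opts q H" "X \<in> opts p G" "s = (q = p)"
        and W: "W = Y * G + H * X - Y * X"
        by (rule opts_timesE)
      have "(p = q) = s"
        using XY(3) by blast
      then show "W \<in> opts s (G * H)"
        using opts_timesI[OF XY(2,1)] swap[OF XY(2,1)] W by simp
    qed
  qed
qed

lemma times_game_zero: "G * 0 = (0 :: 'a::infinite game)"
  by (rule game_opts_eqI) (simp add: opts_times)

lemma times_game_one: "G * 1 = (G :: 'a::infinite game)"
proof (induction G rule: game_induct)
  case (opts G)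
  \<comment> \<open>The only option of \<open>1\<close> is \<open>0\<close>, an option for Left, so
    each option \<open>X\<close> of \<open>G\<close> gives exactly one option of the product, for
    the same player.\<close>
  have eq: "X * 1 + G * 0 - X * 0 = X" if "X \<in> opts p G" for X p
    using opts[OF that] by (simp add: times_game_zero minus_game_def minus_zero_game)
  show ?case
  proof (intro game_opts_eqI equalityI subsetI)
    fix s W
    assume "W \<in> opts s (G * 1)"
    then show "W \<in> opts s G"
      by (rule opts_timesE) (auto simp: opts_one eq split: if_splits)
  next
    fix s X
    assume X: "X \<in> opts s G"
    have "0 \<in> opts True (1 :: 'a game)"
      by (simp add: opts_one)
    from opts_timesI[OF X this] show "X \<in> opts s (G * 1)"
      by (simp add: eq[OF X])
  qed
qed


section \<open>Iteratively zero games\<close>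

lemma iteratively_zero_iff:
  "iteratively_zero G \<longleftrightarrow> (\<forall>s. \<forall>X\<in>opts s G. \<exists>Y\<in>opts (\<not> s) X. iteratively_zero Y)"
  by (subst iteratively_zero.simps) (auto simp: opts_def all_bool_eq)

text \<open>The hypothesis concerns the answer \<open>Y\<close>, two moves below \<open>G\<close>,
  and not the options of \<open>G\<close> themselves.\<close>

lemma iteratively_zero_induct [consumes 1, case_names iteratively_zero]:
  assumes "iteratively_zero G"
    and "\<And>G. (\<And>s X. X \<in> opts s G \<Longrightarrow> \<exists>Y\<in>opts (\<not> s) X. iteratively_zero Y \<and> P Y) \<Longrightarrow> P G"
  shows "P G"
  using assms(1)
  by induction (rule assms(2), auto simp: opts_def split: if_splits)

lemma iteratively_zero_uminus:
  "iteratively_zero G \<Longrightarrow> iteratively_zero (- G :: 'a::infinite game)"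
proof (induction rule: iteratively_zero_induct)
  case (iteratively_zero G)
  show ?case
    unfolding iteratively_zero_iff[of "- G"]
  proof (intro allI ballI)
    fix s W
    assume "W \<in> opts s (- G)"
    then obtain X where X: "X \<in> opts (\<not> s) G" and W: "W = - X"
      by (auto simp: opts_uminus)
    obtain Y where "Y \<in> opts s X" "iteratively_zero (- Y)"
      using iteratively_zero[OF X] by auto
    then show "\<exists>V\<in>opts (\<not> s) W. iteratively_zero V"
      by (auto simp: W opts_uminus)
  qed
qed

lemma iteratively_zero_diff_self: "iteratively_zero (G - G :: 'a::infinite game)"
proof (induction G rule: game_induct)
  case (opts G)
  show ?case
    unfolding iteratively_zero_iff[of "G - G"]
  proof (intro allI ballI)
    fix s W
    assume "W \<in> opts s (G - G)"
    \<comment> \<open>Here \<open>t\<close> is the player for whom \<open>X\<close> is an option of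
      \<open>G\<close>: the mover \<open>s\<close> if the move was in the first summand, the
      opponent if it was in \<open>- G\<close>. The answer copies the move in the other
      summand.\<close>
    then obtain X t where "X \<in> opts t G" "X - G = W \<and> s = t \<or> G - X = W \<and> s = (\<not> t)"
      by (auto simp: minus_game_def opts_plus opts_uminus)
    then have "X - X \<in> opts (\<not> s) W"
      by (auto simp: minus_game_def opts_plus opts_uminus)
    then show "\<exists>Y\<in>opts (\<not> s) W. iteratively_zero Y"
      using opts[OF \<open>X \<in> opts t G\<close>] by blast
  qed
qed

text \<open>Each move is answered in the summand in which it was made; the other summand stays
  unchanged, so the induction is nested.\<close>

lemma iteratively_zero_plus:
  fixes G H :: "'a::infinite game"
  assumes "iteratively_zero G" "iteratively_zero H"
  shows "iteratively_zero (G + H)"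
  using assms
proof (induction G arbitrary: H rule: iteratively_zero_induct)
  case (iteratively_zero G)
  note G = this(1)
  show ?case
    using iteratively_zero(2)
  proof (induction H rule: iteratively_zero_induct)
    case (iteratively_zero H)
    note H = this
    then have "iteratively_zero H"
      by (subst iteratively_zero_iff) blast
    then show ?case
      unfolding iteratively_zero_iff[of "G + H"]
      using G H by (fastforce simp: opts_plus)
  qed
qed

text \<open>
  The answer to a move to \<open>X + Z\<close> may be a move in \<open>Z\<close>. Pretending that the opponent
  restores \<open>Z\<close> to an iteratively zero position, one eventually finds an answer in \<open>X\<close>.
\<close>

lemma iteratively_zero_plus_answer:
  fixes X Z :: "'a::infinite game"
  assumes "iteratively_zero Z" "W \<in> opts s (X + Z)" "iteratively_zero W"
  shows "\<exists>Y\<in>opts s X. \<exists>Z'. iteratively_zero Z' \<and> iteratively_zero (Y + Z')"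
  using assms
proof (induction Z arbitrary: W rule: iteratively_zero_induct)
  case (iteratively_zero Z)
  then have Z: "iteratively_zero Z"
    by (subst iteratively_zero_iff) blast
  from iteratively_zero(2)
  consider (1) Y where "Y \<in> opts s X" "W = Y + Z" | (2) U where "U \<in> opts s Z" "W = X + U"
    by (auto simp: opts_plus)
  then show ?case
  proof cases
    case 1
    then show ?thesis using Z iteratively_zero(3) by blast
  next
    case 2
    obtain V where V: "V \<in> opts (\<not> s) U"
      and IH: "\<And>W. W \<in> opts s (X + V) \<Longrightarrow> iteratively_zero W \<Longrightarrow>
        \<exists>Y\<in>opts s X. \<exists>Z'. iteratively_zero Z' \<and> iteratively_zero (Y + Z')"
      using iteratively_zero(1)[OF 2(1)] by blast
    \<comment> \<open>As \<open>W = X + U\<close> is iteratively zero, the opponent's move to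
      \<open>X + V\<close> has an answer \<open>W'\<close>, which is the situation of the induction
      hypothesis for \<open>V\<close>.\<close>
    have "X + V \<in> opts (\<not> s) W"
      using V 2 by (auto simp: opts_plus)
    then obtain W' where "W' \<in> opts s (X + V)" "iteratively_zero W'"
      using iteratively_zero(3)[unfolded iteratively_zero_iff[of W]] by force
    then show ?thesis by (rule IH)
  qed
qed

lemma iteratively_zero_cancel:
  fixes G Z :: "'a::infinite game"
  assumes "iteratively_zero (G + Z)" "iteratively_zero Z"
  shows "iteratively_zero G"
  using assms
\<comment> \<open>The answer \<open>Y\<close> lies two moves below \<open>G\<close>, hence the
  transitive closure; it comes with a new game \<open>Z'\<close>, hence the arbitrary
  \<open>Z\<close>.\<close>
proof (induction G arbitrary: Z rule: wf_induct_rule[OF wf_trancl[OF wf_opts_rel]])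
  case (1 G)
  show ?case
    unfolding iteratively_zero_iff[of G]
  proof (intro allI ballI)
    fix s X
    assume X: "X \<in> opts s G"
    then have "X + Z \<in> opts s (G + Z)"
      by (simp add: opts_plus)
    then obtain W where W: "W \<in> opts (\<not> s) (X + Z)" "iteratively_zero W"
      using \<open>iteratively_zero (G + Z)\<close>[unfolded iteratively_zero_iff[of "G + Z"]] by blast
    obtain Y Z' where Y: "Y \<in> opts (\<not> s) X"
      and Z': "iteratively_zero Z'" "iteratively_zero (Y + Z')"
      using iteratively_zero_plus_answer[OF \<open>iteratively_zero Z\<close> W] by blast
    have "(Y, X) \<in> opts_rel" "(X, G) \<in> opts_rel"
      using X Y by (auto simp: opts_def split: if_splits)
    then have "(Y, G) \<in> opts_rel\<^sup>+"
      by auto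
    then have "iteratively_zero Y"
      using 1(1) Z' by blast
    then show "\<exists>Y\<in>opts (\<not> s) X. iteratively_zero Y"
      using Y by blast
  qed
qed


section \<open>The additive group of games modulo iterative equivalence\<close>

lemma iter_equiv_refl: "G \<equiv>\<^sub>i G"
  by (simp add: iter_equiv_def iteratively_zero_diff_self)

lemma iter_equiv_sym: "G \<equiv>\<^sub>i H \<Longrightarrow> H \<equiv>\<^sub>i G"
  unfolding iter_equiv_def using iteratively_zero_uminus minus_diff_game by metis

lemma iter_equiv_trans:
  assumes "G \<equiv>\<^sub>i H" "H \<equiv>\<^sub>i K"
  shows "G \<equiv>\<^sub>i K"
proof -
  \<comment> \<open>The middle terms \<open>H\<close> and \<open>- H\<close> do not vanish as forms,
    but their sum is iteratively zero and can be cancelled.\<close>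
  have "(G - K) + (H - H) = (G - H) + (H - K)"
    by (simp add: minus_game_def ac_simps)
  then have "iteratively_zero ((G - K) + (H - H))"
    using assms by (simp add: iter_equiv_def iteratively_zero_plus)
  then show ?thesis
    unfolding iter_equiv_def using iteratively_zero_diff_self by (rule iteratively_zero_cancel)
qed

lemma equivp_iter_equiv: "equivp (iter_equiv :: 'a::infinite game \<Rightarrow> 'a game \<Rightarrow> bool)"
  by (intro equivpI reflpI sympI transpI) (blast intro: iter_equiv_refl iter_equiv_sym iter_equiv_trans)+

lemma iter_equiv_plus:
  assumes "G \<equiv>\<^sub>i H" "K \<equiv>\<^sub>i J"
  shows "G + K \<equiv>\<^sub>i H + J"
proof -
  have "(G + K) - (H + J) = (G - H) + (K - J)"
    by (simp add: minus_game_def minus_plus_game ac_simps)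
  then show ?thesis
    using assms by (simp add: iter_equiv_def iteratively_zero_plus)
qed

lemma iter_equiv_uminus:
  assumes "G \<equiv>\<^sub>i H"
  shows "- G \<equiv>\<^sub>i - H"
proof -
  have "(- G) - (- H) = - (G - H)"
    by (simp add: minus_game_def minus_plus_game)
  then show ?thesis
    using assms by (simp add: iter_equiv_def iteratively_zero_uminus)
qed

lemma iter_equiv_zero_iff: "G \<equiv>\<^sub>i 0 \<longleftrightarrow> iteratively_zero G"
  by (simp add: iter_equiv_def minus_game_def minus_zero_game)

lemma iter_equiv_optsI:
  fixes G H :: "'a::infinite game"
  assumes "\<And>s X. X \<in> opts s G \<Longrightarrow> \<exists>Y\<in>opts s H. X \<equiv>\<^sub>i Y"
    and "\<And>s Y. Y \<in> opts s H \<Longrightarrow> \<exists>X\<in>opts s G. X \<equiv>\<^sub>i Y"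
  shows "G \<equiv>\<^sub>i H"
  unfolding iter_equiv_def iteratively_zero_iff[of "G - H"]
proof (intro allI ballI)
  fix s W
  assume "W \<in> opts s (G - H)"
  then consider X where "X \<in> opts s G" "W = X - H" | Y where "Y \<in> opts (\<not> s) H" "W = G - Y"
    by (auto simp: minus_game_def opts_plus opts_uminus)
  then show "\<exists>V\<in>opts (\<not> s) W. iteratively_zero V"
  proof cases
    case 1
    then show ?thesis
      using assms(1)[of X s] by (force simp: minus_game_def opts_plus opts_uminus iter_equiv_def)
  next
    case 2
    then show ?thesis
      using assms(2)[of Y "\<not> s"] by (force simp: minus_game_def opts_plus opts_uminus iter_equiv_def)
  qed
qed

lemma option_regular_iter_equiv:
  "option_regular (iter_equiv :: 'a::infinite game \<Rightarrow> 'a game \<Rightarrow> bool)"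
  unfolding option_regular_def
proof (intro allI impI, elim conjE)
  fix G H :: "'a game"
  assume A: "\<forall>X\<in>left_opts G. \<exists>Y\<in>left_opts H. X \<equiv>\<^sub>i Y" "\<forall>Y\<in>left_opts H. \<exists>X\<in>left_opts G. Y \<equiv>\<^sub>i X"
    "\<forall>X\<in>right_opts G. \<exists>Y\<in>right_opts H. X \<equiv>\<^sub>i Y" "\<forall>Y\<in>right_opts H. \<exists>X\<in>right_opts G. Y \<equiv>\<^sub>i X"
  show "G \<equiv>\<^sub>i H"
    by (rule iter_equiv_optsI; use A iter_equiv_sym in \<open>fastforce simp: opts_def split: if_splits\<close>)
qed

\<comment> \<open>This type serves for calculation: as an instance of \<open>ab_group_add\<close> it
  lets the simplifier compare options by the laws of abelian groups.\<close>
quotient_type 'a iter_class = "'a::infinite game" / iter_equiv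
  by (fact equivp_iter_equiv)

instantiation iter_class :: (infinite) ab_group_add
begin

lift_definition zero_iter_class :: "'a iter_class" is 0 .

lift_definition plus_iter_class :: "'a iter_class \<Rightarrow> 'a iter_class \<Rightarrow> 'a iter_class" is "(+)"
  by (rule iter_equiv_plus)

lift_definition uminus_iter_class :: "'a iter_class \<Rightarrow> 'a iter_class" is uminus
  by (rule iter_equiv_uminus)

lift_definition minus_iter_class :: "'a iter_class \<Rightarrow> 'a iter_class \<Rightarrow> 'a iter_class" is "(-)"
  unfolding minus_game_def by (intro iter_equiv_plus iter_equiv_uminus)

instance
proof
  fix a b c :: "'a iter_class"
  show "a + b + c = a + (b + c)"
    by transfer (simp add: add.assoc iter_equiv_refl)
  show "a + b = b + a"
    by transfer (simp add: add.commute iter_equiv_refl)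
  show "0 + a = a"
    by transfer (simp add: iter_equiv_refl)
  show "- a + a = 0"
    by transfer (metis add.commute iter_equiv_zero_iff iteratively_zero_diff_self minus_game_def)
  show "a - b = a + - b"
    by transfer (simp add: minus_game_def iter_equiv_refl)
qed

end

abbreviation cls :: "'a::infinite game \<Rightarrow> 'a iter_class" where
  "cls \<equiv> abs_iter_class"

lemma cls_eq_iff: "cls G = cls H \<longleftrightarrow> G \<equiv>\<^sub>i H"
  by (rule iter_class.abs_eq_iff)

lemma cls_eq_zero_iff: "cls G = 0 \<longleftrightarrow> iteratively_zero G"
  by (simp add: zero_iter_class_def cls_eq_iff iter_equiv_zero_iff)

lemma cls_plus [simp]: "cls (G + H) = cls G + cls H"
  by (simp add: plus_iter_class.abs_eq)

lemma cls_uminus [simp]: "cls (- G) = - cls G"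
  by (simp add: uminus_iter_class.abs_eq)

lemma cls_diff [simp]: "cls (G - H) = cls G - cls H"
  by (simp add: minus_iter_class.abs_eq)

text \<open>Option-regularity as a proof rule for equations: options have to agree only as
  classes.\<close>

lemma cls_optsI:
  assumes "\<And>s X. X \<in> opts s G \<Longrightarrow> \<exists>Y\<in>opts s H. cls X = cls Y"
    and "\<And>s Y. Y \<in> opts s H \<Longrightarrow> \<exists>X\<in>opts s G. cls X = cls Y"
  shows "cls G = cls H"
  using assms unfolding cls_eq_iff by (rule iter_equiv_optsI)


section \<open>Products modulo iterative equivalence\<close>

lemma cls_distrib_left: "cls (G * (H + K)) = cls (G * H) + cls (G * K)"
proof (induction G arbitrary: H K rule: game_induct)
  case (opts G)
  note G = this
  show ?case
  proof (induction H arbitrary: K rule: game_induct)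
    case (opts H)
    note H = this
    show ?case
    proof (induction K rule: game_induct)
      case (opts K)
      note K = this
      \<comment> \<open>Expanding the left side by the induction hypotheses leaves
        \<open>X * K - X * K\<close>, which cancels only modulo \<open>\<equiv>\<^sub>i\<close>;
        this is why distributivity is proved for classes.\<close>
      have eqH: "cls (X * (H + K) + G * (Y + K) - X * (Y + K)) = cls ((X * H + G * Y - X * Y) + G * K)"
        if "X \<in> opts p G" "Y \<in> opts q H" for X Y p q
        using that by (simp add: G H)
      have eqK: "cls (X * (H + K) + G * (H + Y) - X * (H + Y)) = cls (G * H + (X * K + G * Y - X * Y))"
        if "X \<in> opts p G" "Y \<in> opts q K" for X Y p q
        using that by (simp add: G K)
      have "cls (G * (H + K)) = cls (G * H + G * K)"
      proof (rule cls_optsI)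
        fix s W
        assume "W \<in> opts s (G * (H + K))"
        then obtain p q X V where X: "X \<in> opts p G" and V: "V \<in> opts q (H + K)" and s: "s = (p = q)"
          and W: "W = X * (H + K) + G * V - X * V"
          by (rule opts_timesE)
        from V consider Y where "Y \<in> opts q H" "V = Y + K" | Y where "Y \<in> opts q K" "V = H + Y"
          by (auto simp: opts_plus)
        then show "\<exists>U\<in>opts s (G * H + G * K). cls W = cls U"
        proof cases
          case (1 Y)
          have "(X * H + G * Y - X * Y) + G * K \<in> opts s (G * H + G * K)"
            using opts_timesI[OF X 1(1)] by (simp add: opts_plus s)
          then show ?thesis
            unfolding W 1(2) using eqH[OF X 1(1)] by (rule bexI[rotated])
        next
          case (2 Y)
          have "G * H + (X * K + G * Y - X * Y) \<in> opts s (G * H + G * K)"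
            using opts_timesI[OF X 2(1)] by (simp add: opts_plus s)
          then show ?thesis
            unfolding W 2(2) using eqK[OF X 2(1)] by (rule bexI[rotated])
        qed
      next
        fix s U
        assume "U \<in> opts s (G * H + G * K)"
        then consider V where "V \<in> opts s (G * H)" "U = V + G * K"
          | V where "V \<in> opts s (G * K)" "U = G * H + V"
          by (auto simp: opts_plus)
        then show "\<exists>W\<in>opts s (G * (H + K)). cls W = cls U"
        proof cases
          case (1 V)
          obtain p q X Y where XY: "X \<in> opts p G" "Y \<in> opts q H" "s = (p = q)"
            and V: "V = X * H + G * Y - X * Y"
            using 1(1) by (rule opts_timesE)
          have "Y + K \<in> opts q (H + K)"
            using XY by (simp add: opts_plus)
          from opts_timesI[OF XY(1) this] show ?thesis
            unfolding 1(2) V XY(3) using eqH[OF XY(1,2)] by (rule bexI[rotated])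
        next
          case (2 V)
          obtain p q X Y where XY: "X \<in> opts p G" "Y \<in> opts q K" "s = (p = q)"
            and V: "V = X * K + G * Y - X * Y"
            using 2(1) by (rule opts_timesE)
          have "H + Y \<in> opts q (H + K)"
            using XY by (simp add: opts_plus)
          from opts_timesI[OF XY(1) this] show ?thesis
            unfolding 2(2) V XY(3) using eqK[OF XY(1,2)] by (rule bexI[rotated])
        qed
      qed
      then show ?case by simp
    qed
  qed
qed

lemma cls_distrib_right: "cls ((G + H) * K) = cls (G * K) + cls (H * K)"
  by (metis cls_distrib_left times_game_commute)

lemma iteratively_zero_times:
  fixes Z K :: "'a::infinite game"
  assumes "iteratively_zero Z"
  shows "iteratively_zero (Z * K)"
  using assms
proof (induction Z arbitrary: K rule: iteratively_zero_induct)
  case (iteratively_zero Z)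
  note Z = this
  show ?case
  proof (induction K rule: game_induct)
    case (opts K)
    note K = this
    show ?case
      unfolding iteratively_zero_iff[of "Z * K"]
    proof (intro allI ballI)
      fix s W
      assume "W \<in> opts s (Z * K)"
      then obtain p q X Y where X: "X \<in> opts p Z" and Y: "Y \<in> opts q K" and s: "s = (p = q)"
        and W: "W = X * K + Z * Y - X * Y"
        by (rule opts_timesE)
      \<comment> \<open>The hypothesis for \<open>X'\<close> is kept for all second factors, as it
        is applied to both \<open>K\<close> and \<open>Y\<close>.\<close>
      obtain X' where X': "X' \<in> opts (\<not> p) X" and zero: "\<And>K. iteratively_zero (X' * K)"
        using Z[OF X] by blast
      let ?V = "(X' * K + X * Y - X' * Y) + Z * Y - X * Y"
      \<comment> \<open>Replacing the player \<open>p\<close> of the first factor by the opponent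
        also reverses the player of the product option.\<close>
      have "((\<not> p) = q) = (\<not> s)"
        using s by blast
      then have "?V \<in> opts (\<not> s) W"
        using opts_timesI[OF X' Y] by (auto simp: W minus_game_def opts_plus)
      moreover have "iteratively_zero ?V"
        using zero[of K] zero[of Y] K[OF Y] unfolding cls_eq_zero_iff[symmetric] by simp
      ultimately show "\<exists>V\<in>opts (\<not> s) W. iteratively_zero V"
        by blast
    qed
  qed
qed

text \<open>Not even negatives are lifted through products by a separate induction:
  \<open>(G - G) * H\<close> is iteratively zero, and distributivity does the rest.\<close>

lemma cls_uminus_times: "cls (- G * H) = - cls (G * H)"
proof -
  have "cls (G * H) + cls (- G * H) = cls ((G - G) * H)"
    by (simp add: minus_game_def cls_distrib_right)
  also have "\<dots> = 0"
    by (simp add: cls_eq_zero_iff iteratively_zero_times iteratively_zero_diff_self)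
  finally show ?thesis
    by (simp add: eq_neg_iff_add_eq_0 add.commute)
qed

lemma cls_diff_times: "cls ((G - H) * K) = cls (G * K) - cls (H * K)"
  by (simp add: minus_game_def cls_distrib_right cls_uminus_times)

lemma cls_times_diff: "cls (G * (H - K)) = cls (G * H) - cls (G * K)"
  by (metis cls_diff_times times_game_commute)

lemma iter_equiv_times_right:
  assumes "G \<equiv>\<^sub>i H"
  shows "G * K \<equiv>\<^sub>i H * K"
proof -
  have "cls ((G - H) * K) = 0"
    using assms by (simp add: cls_eq_zero_iff iter_equiv_def iteratively_zero_times)
  then show ?thesis
    by (simp add: cls_diff_times cls_eq_iff[symmetric])
qed

lemma iter_equiv_times: "G \<equiv>\<^sub>i H \<Longrightarrow> K \<equiv>\<^sub>i J \<Longrightarrow> G * K \<equiv>\<^sub>i H * J"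
  by (metis iter_equiv_times_right iter_equiv_trans times_game_commute)

lemma cls_times_assoc: "cls ((G * H) * K) = cls (G * (H * K))"
proof (induction G arbitrary: H K rule: game_induct)
  case (opts G)
  note G = this
  show ?case
  proof (induction H arbitrary: K rule: game_induct)
    case (opts H)
    note H = this
    show ?case
    proof (induction K rule: game_induct)
      case (opts K)
      note K = this
      \<comment> \<open>Modulo distributivity, both sides are signed sums of the seven triple
        products with factors from \<open>G\<close> or \<open>X\<close>, \<open>H\<close> or
        \<open>Y\<close>, \<open>K\<close> or \<open>Z\<close>, other than that of \<open>G\<close>,
        \<open>H\<close>, \<open>K\<close>. Each contains a proper option, so an induction
        hypothesis rebrackets it.\<close>
      have eq: "cls ((X * H + G * Y - X * Y) * K + (G * H) * Z - (X * H + G * Y - X * Y) * Z)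
          = cls (X * (H * K) + G * (Y * K + H * Z - Y * Z) - X * (Y * K + H * Z - Y * Z))"
        if "X \<in> opts p G" "Y \<in> opts q H" "Z \<in> opts r K" for X Y Z p q r
        using that
        by (simp add: cls_distrib_left cls_distrib_right cls_diff_times cls_times_diff G H K algebra_simps)
      show ?case
      proof (rule cls_optsI)
        fix s W
        assume "W \<in> opts s ((G * H) * K)"
        then obtain t r V Z where V: "V \<in> opts t (G * H)" and Z: "Z \<in> opts r K" and s: "s = (t = r)"
          and W: "W = V * K + (G * H) * Z - V * Z"
          by (rule opts_timesE)
        obtain p q X Y where X: "X \<in> opts p G" and Y: "Y \<in> opts q H" and t: "t = (p = q)"
          and V': "V = X * H + G * Y - X * Y"
          using V by (rule opts_timesE)
        \<comment> \<open>Equality of truth values is associative, so both bracketings give the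
          option to the same player.\<close>
        have "s = (p = (q = r))"
          using s t by blast
        then show "\<exists>U\<in>opts s (G * (H * K)). cls W = cls U"
          unfolding W V' using eq[OF X Y Z] opts_timesI[OF X opts_timesI[OF Y Z]] by blast
      next
        fix s U
        assume "U \<in> opts s (G * (H * K))"
        then obtain p t X V where X: "X \<in> opts p G" and V: "V \<in> opts t (H * K)" and s: "s = (p = t)"
          and U: "U = X * (H * K) + G * V - X * V"
          by (rule opts_timesE)
        obtain q r Y Z where Y: "Y \<in> opts q H" and Z: "Z \<in> opts r K" and t: "t = (q = r)"
          and V': "V = Y * K + H * Z - Y * Z"
          using V by (rule opts_timesE)
        have "s = ((p = q) = r)"
          using s t by blast
        then show "\<exists>W\<in>opts s ((G * H) * K). cls W = cls U"
          unfolding U V' using eq[OF X Y Z] opts_timesI[OF opts_timesI[OF X Y] Z] by blast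
      qed
    qed
  qed
qed


section \<open>The quotient Ring\<close>

lemma iter_rel_Image_eq_iff: "iter_rel `` {G} = iter_rel `` {H} \<longleftrightarrow> cls G = cls H"
  unfolding cls_eq_iff iter_rel_def using iter_equiv_refl iter_equiv_sym iter_equiv_trans by blast

text \<open>For an operation that respects \<open>\<equiv>\<^sub>i\<close>, the union in
  \<open>iter_quotient\<close> ranges over copies of one class, and it is nonempty because of
  \<open>G\<close> and \<open>H\<close>.\<close>

lemma UN_iter_rel:
  assumes "\<And>X Y. G \<equiv>\<^sub>i X \<Longrightarrow> H \<equiv>\<^sub>i Y \<Longrightarrow> f G H \<equiv>\<^sub>i f X Y"
  shows "(\<Union>X\<in>iter_rel `` {G}. \<Union>Y\<in>iter_rel `` {H}. iter_rel `` {f X Y}) = iter_rel `` {f G H}"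
proof -
  have "iter_rel `` {f X Y} = iter_rel `` {f G H}"
    if "X \<in> iter_rel `` {G}" "Y \<in> iter_rel `` {H}" for X Y
  proof -
    have "f G H \<equiv>\<^sub>i f X Y"
      using that assms by (simp add: iter_rel_def)
    then show ?thesis
      by (simp add: iter_rel_Image_eq_iff cls_eq_iff iter_equiv_sym)
  qed
  moreover have "G \<in> iter_rel `` {G}" "H \<in> iter_rel `` {H}"
    by (simp_all add: iter_rel_def iter_equiv_refl)
  ultimately show ?thesis
    by blast
qed

lemma carrier_iter_quotient: "carrier iter_quotient = range (\<lambda>G. iter_rel `` {G})"
  by (auto simp: iter_quotient_def quotient_def)

lemma iter_quotient_simps:
  "iter_rel `` {G} \<otimes>\<^bsub>iter_quotient\<^esub> iter_rel `` {H} = iter_rel `` {G * H}"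
  "iter_rel `` {G} \<oplus>\<^bsub>iter_quotient\<^esub> iter_rel `` {H} = iter_rel `` {G + H}"
  "\<one>\<^bsub>iter_quotient\<^esub> = iter_rel `` {1}"
  "\<zero>\<^bsub>iter_quotient\<^esub> = iter_rel `` {0}"
  unfolding iter_quotient_def
  by (simp_all add: UN_iter_rel iter_equiv_plus iter_equiv_times)

lemma cring_iter_quotient: "cring (iter_quotient :: 'a::infinite game set ring)"
proof (rule cringI)
  show "abelian_group (iter_quotient :: 'a game set ring)"
  proof (rule abelian_groupI)
    fix x :: "'a game set"
    assume "x \<in> carrier iter_quotient"
    then obtain G where x: "x = iter_rel `` {G}"
      by (auto simp: carrier_iter_quotient)
    have "iter_rel `` {- G} \<oplus>\<^bsub>iter_quotient\<^esub> x = \<zero>\<^bsub>iter_quotient\<^esub>"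
      by (simp add: x iter_quotient_simps iter_rel_Image_eq_iff zero_iter_class_def[symmetric])
    then show "\<exists>y\<in>carrier iter_quotient. y \<oplus>\<^bsub>iter_quotient\<^esub> x = \<zero>\<^bsub>iter_quotient\<^esub>"
      by (auto simp: carrier_iter_quotient)
  qed (auto simp: carrier_iter_quotient iter_quotient_simps ac_simps)
  show "comm_monoid (iter_quotient :: 'a game set ring)"
  proof (rule comm_monoidI)
    fix x y z :: "'a game set"
    assume "x \<in> carrier iter_quotient" "y \<in> carrier iter_quotient" "z \<in> carrier iter_quotient"
    then obtain G H K where xyz: "x = iter_rel `` {G}" "y = iter_rel `` {H}" "z = iter_rel `` {K}"
      by (auto simp: carrier_iter_quotient)
    show "x \<otimes>\<^bsub>iter_quotient\<^esub> y \<otimes>\<^bsub>iter_quotient\<^esub> z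
        = x \<otimes>\<^bsub>iter_quotient\<^esub> (y \<otimes>\<^bsub>iter_quotient\<^esub> z)"
      by (simp add: xyz iter_quotient_simps iter_rel_Image_eq_iff cls_times_assoc)
  next
    fix x y :: "'a game set"
    assume "x \<in> carrier iter_quotient" "y \<in> carrier iter_quotient"
    then show "x \<otimes>\<^bsub>iter_quotient\<^esub> y = y \<otimes>\<^bsub>iter_quotient\<^esub> x"
      by (auto simp only: carrier_iter_quotient iter_quotient_simps times_game_commute)
  qed (auto simp: carrier_iter_quotient iter_quotient_simps times_game_commute[of 1] times_game_one)
next
  fix x y z :: "'a game set"
  assume "x \<in> carrier iter_quotient" "y \<in> carrier iter_quotient" "z \<in> carrier iter_quotient"
  then obtain G H K where xyz: "x = iter_rel `` {G}" "y = iter_rel `` {H}" "z = iter_rel `` {K}"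
    by (auto simp: carrier_iter_quotient)
  show "(x \<oplus>\<^bsub>iter_quotient\<^esub> y) \<otimes>\<^bsub>iter_quotient\<^esub> z
      = x \<otimes>\<^bsub>iter_quotient\<^esub> z \<oplus>\<^bsub>iter_quotient\<^esub> y \<otimes>\<^bsub>iter_quotient\<^esub> z"
    by (simp add: xyz iter_quotient_simps iter_rel_Image_eq_iff cls_distrib_right)
qed

theorem theorem4p7:
  shows "equivp (iter_equiv :: 'a::infinite game \<Rightarrow> 'a game \<Rightarrow> bool)
    \<and> option_regular (iter_equiv :: 'a game \<Rightarrow> 'a game \<Rightarrow> bool)
    \<and> (\<forall>G H K J :: 'a game. G \<equiv>\<^sub>i H \<and> K \<equiv>\<^sub>i J \<longrightarrow> G + K \<equiv>\<^sub>i H + J \<and> G * K \<equiv>\<^sub>i H * J)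
    \<and> cring (iter_quotient :: 'a game set ring)"
  by (blast intro: equivp_iter_equiv option_regular_iter_equiv iter_equiv_plus iter_equiv_times
      cring_iter_quotient)

end
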